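(* Let $\mathcal{C}$ be a small category with weak pullbacks. If an internal frame $L\in\mathsf{Frm}[\mathcal{C}^{op},\mathsf{Set}]$ is (internally) locally compact, then all its sections $La$, $a\in\mathcal{C}$, are locally compact frames.
   Context: For an arrow $f$ of $\mathcal{C}$, $\vartheta_0 f$ is its source and $\vartheta_1 f$ its target. An internal frame in $[\mathcal{C}^{op},\mathsf{Set}]$ is (described as) a functor $L$ from $\mathcal{C}^{op}$ to frames such that each $Lf\colon La\to Lb$ ($f\colon b\to a$) has a left adjoint $\Sigma_f\colon Lb\to La$ satisfying the Beck-Chevalley condition $Ls\circ\Sigma_r=\Sigma_q\circ Lp$ for every weak pullback square $rp=sq$ in $\mathcal{C}$, and Frobenius reciprocity $\Sigma_f(Lf(u)\wedge v)=u\wedge\Sigma_f v$. For a lattice $K$, $\mathrm{idl}\,K$ is the poset of ideals of $K$ (subsets containing $0$, downward closed, closed under binary joins) ordered by inclusion; for a map $h\colon K\to K'$ and $I\subseteq K$, $h[I]$ denotes the ideal generated by the direct image of $I$. The way-below relation on a frame: $x\ll y$ iff for every directed $S$ with $y\le\bigvee S$ there is $s\in S$ with $x\le s$. A frame $K$ is locally compact if it is a continuous lattice, i.e. for every $x$ the set $\{y\mid y\ll x\}$ is directed with supremum $x$; equivalently, the supremum map $\bigvee\colon\mathrm{idl}\,K\to K$ has a left adjoint. The internal ideal object of an internal frame $L$ is the presheaf of posets $\mathrm{idl}_{\hat{\mathcal{C}}}L$ with $$\mathrm{idl}_{\hat{\mathcal{C}}}L(a)=\Big\{(I_f)_{\vartheta_1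 f=a}\ \Big|\ I_f\in\mathrm{idl}(L(\vartheta_0 f)),\ Lg[I_f]\subseteq I_{fg}\text{ whenever }\vartheta_1 g=\vartheta_0 f\Big\},$$ ordered by componentwise inclusion, with transition along $r\colon b\to a$ given by $(I_f)_{\vartheta_1 f=a}\mapsto(I_{rh})_{\vartheta_1 h=b}$. The internal supremum map $S\colon\mathrm{idl}_{\hat{\mathcal{C}}}L\to L$ is $S_a((I_f)_{\vartheta_1 f=a})=\bigvee\bigcup_{\vartheta_1 f=a}\Sigma_f[I_f]$. The internal frame $L$ is (internally) locally compact if there is a natural transformation of presheaves of posets $\Lambda\colon L\to\mathrm{idl}_{\hat{\mathcal{C}}}L$ left adjoint to $S$ (i.e. $\Lambda_a\dashv S_a$ for all $a$). *)

theory Defs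
  imports "HOL-Algebra.Galois_Connection"
begin

section \<open>Small categories\<close>

record ('o, 'm) cat =
  obj :: "'o set"
  arr :: "'m set"
  src :: "'m \<Rightarrow> 'o"
  tgt :: "'m \<Rightarrow> 'o"
  ident :: "'o \<Rightarrow> 'm"
  comp :: "'m \<Rightarrow> 'm \<Rightarrow> 'm"  (infixl "\<cdot>\<index>" 70)

text \<open>\<open>f \<cdot> g\<close> means \<open>f\<close> after \<open>g\<close>; it is meaningful only if \<open>src f = tgt g\<close>.\<close>

locale category =
  fixes C :: "('o, 'm) cat" (structure)
  assumes src_obj: "f \<in> arr C \<Longrightarrow> src C f \<in> obj C"
    and tgt_obj: "f \<in> arr C \<Longrightarrow> tgt C f \<in> obj C"
    and ident_arr: "a \<in> obj C \<Longrightarrow> ident C a \<in> arr C"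
    and src_ident: "a \<in> obj C \<Longrightarrow> src C (ident C a) = a"
    and tgt_ident: "a \<in> obj C \<Longrightarrow> tgt C (ident C a) = a"
    and comp_arr: "\<lbrakk>f \<in> arr C; g \<in> arr C; src C f = tgt C g\<rbrakk> \<Longrightarrow> f \<cdot> g \<in> arr C"
    and src_comp: "\<lbrakk>f \<in> arr C; g \<in> arr C; src C f = tgt C g\<rbrakk> \<Longrightarrow> src C (f \<cdot> g) = src C g"
    and tgt_comp: "\<lbrakk>f \<in> arr C; g \<in> arr C; src C f = tgt C g\<rbrakk> \<Longrightarrow> tgt C (f \<cdot> g) = tgt C f"
    and comp_ident: "f \<in> arr C \<Longrightarrow> f \<cdot> ident C (src C f) = f"
    and ident_comp: "f \<in> arr C \<Longrightarrow> ident C (tgt C f) \<cdot> f = f"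
    and comp_assoc: "\<lbrakk>f \<in> arr C; g \<in> arr C; h \<in> arr C; src C f = tgt C g; src C g = tgt C h\<rbrakk>
      \<Longrightarrow> (f \<cdot> g) \<cdot> h = f \<cdot> (g \<cdot> h)"

definition arrows_into :: "('o, 'm) cat \<Rightarrow> 'o \<Rightarrow> 'm set" where
  "arrows_into C a = {f \<in> arr C. tgt C f = a}"

text \<open>A commutative square \<open>r \<cdot> p = s \<cdot> q\<close> through which every other such square factors,
  not necessarily uniquely.\<close>

definition weak_pullback :: "('o, 'm) cat \<Rightarrow> 'm \<Rightarrow> 'm \<Rightarrow> 'm \<Rightarrow> 'm \<Rightarrow> bool" where
  "weak_pullback C r s p q \<longleftrightarrow>
     r \<in> arr C \<and> s \<in> arr C \<and> p \<in> arr C \<and> q \<in> arr C \<and>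
     tgt C r = tgt C s \<and> src C p = src C q \<and> tgt C p = src C r \<and> tgt C q = src C s \<and>
     r \<cdot>\<^bsub>C\<^esub> p = s \<cdot>\<^bsub>C\<^esub> q \<and>
     (\<forall>p'\<in>arr C. \<forall>q'\<in>arr C.
        src C p' = src C q' \<and> tgt C p' = src C r \<and> tgt C q' = src C s \<and>
        r \<cdot>\<^bsub>C\<^esub> p' = s \<cdot>\<^bsub>C\<^esub> q' \<longrightarrow>
        (\<exists>k\<in>arr C. src C k = src C p' \<and> tgt C k = src C p \<and>
                   p \<cdot>\<^bsub>C\<^esub> k = p' \<and> q \<cdot>\<^bsub>C\<^esub> k = q'))"

definition has_weak_pullbacks :: "('o, 'm) cat \<Rightarrow> bool" where
  "has_weak_pullbacks C \<longleftrightarrow>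
     (\<forall>r\<in>arr C. \<forall>s\<in>arr C. tgt C r = tgt C s \<longrightarrow> (\<exists>p q. weak_pullback C r s p q))"


section \<open>Frames, ideals and local compactness\<close>

locale frame = complete_lattice K for K :: "'l gorder" (structure) +
  assumes meet_Sup_distrib:
    "\<lbrakk>x \<in> carrier K; A \<subseteq> carrier K\<rbrakk> \<Longrightarrow> x \<sqinter> (\<Squnion>A) = \<Squnion>((\<lambda>y. x \<sqinter> y) ` A)"

definition frame_hom :: "'l gorder \<Rightarrow> 'k gorder \<Rightarrow> ('l \<Rightarrow> 'k) \<Rightarrow> bool" where
  "frame_hom K K' h \<longleftrightarrow>
     h \<in> carrier K \<rightarrow> carrier K' \<and> sup_pres K K' h \<and> meet_pres K K' h \<and>
     h \<top>\<^bsub>K\<^esub> = \<top>\<^bsub>K'\<^esub>"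

definition lattice_ideal :: "'l gorder \<Rightarrow> 'l set \<Rightarrow> bool" where
  "lattice_ideal K I \<longleftrightarrow>
     I \<subseteq> carrier K \<and> \<bottom>\<^bsub>K\<^esub> \<in> I \<and>
     (\<forall>x\<in>I. \<forall>y\<in>carrier K. y \<sqsubseteq>\<^bsub>K\<^esub> x \<longrightarrow> y \<in> I) \<and>
     (\<forall>x\<in>I. \<forall>y\<in>I. x \<squnion>\<^bsub>K\<^esub> y \<in> I)"

definition idl :: "'l gorder \<Rightarrow> 'l set gorder" where
  "idl K = \<lparr>carrier = {I. lattice_ideal K I}, eq = (=), le = (\<subseteq>)\<rparr>"

definition ideal_generated :: "'l gorder \<Rightarrow> 'l set \<Rightarrow> 'l set" where
  "ideal_generated K X = \<Inter>{I \<in> carrier (idl K). X \<subseteq> I}"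

text \<open>The ideal \<open>h[I]\<close> of the codomain \<open>K'\<close> of \<open>h\<close>.\<close>

definition ideal_image :: "'k gorder \<Rightarrow> ('l \<Rightarrow> 'k) \<Rightarrow> 'l set \<Rightarrow> 'k set" where
  "ideal_image K' h I = ideal_generated K' (h ` I)"

definition directed :: "'l gorder \<Rightarrow> 'l set \<Rightarrow> bool" where
  "directed K D \<longleftrightarrow>
     D \<subseteq> carrier K \<and> D \<noteq> {} \<and> (\<forall>x\<in>D. \<forall>y\<in>D. \<exists>z\<in>D. x \<sqsubseteq>\<^bsub>K\<^esub> z \<and> y \<sqsubseteq>\<^bsub>K\<^esub> z)"

definition way_below :: "'l gorder \<Rightarrow> 'l \<Rightarrow> 'l \<Rightarrow> bool" where
  "way_below K x y \<longleftrightarrow>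
     (\<forall>D. directed K D \<and> y \<sqsubseteq>\<^bsub>K\<^esub> \<Squnion>\<^bsub>K\<^esub>D \<longrightarrow> (\<exists>d\<in>D. x \<sqsubseteq>\<^bsub>K\<^esub> d))"

definition locally_compact_frame :: "'l gorder \<Rightarrow> bool" where
  "locally_compact_frame K \<longleftrightarrow>
     frame K \<and>
     (\<forall>x\<in>carrier K. directed K {y \<in> carrier K. way_below K y x} \<and>
                    is_lub K x {y \<in> carrier K. way_below K y x})"


section \<open>Presheaves of posets\<close>

text \<open>\<open>trans F f\<close> is the transition map \<open>F f : F (tgt f) \<rightarrow> F (src f)\<close>.\<close>

record ('o, 'm, 'l) presheaf =
  sec :: "'o \<Rightarrow> 'l gorder"
  trans :: "'m \<Rightarrow> 'l \<Rightarrow> 'l"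

locale poset_presheaf = category C for C :: "('o, 'm) cat" (structure) +
  fixes F :: "('o, 'm, 'l) presheaf"
  assumes sec_poset: "a \<in> obj C \<Longrightarrow> partial_order (sec F a)"
    and trans_closed: "f \<in> arr C \<Longrightarrow>
      trans F f \<in> carrier (sec F (tgt C f)) \<rightarrow> carrier (sec F (src C f))"
    and trans_mono: "f \<in> arr C \<Longrightarrow>
      isotone (sec F (tgt C f)) (sec F (src C f)) (trans F f)"
    and trans_ident: "\<lbrakk>a \<in> obj C; x \<in> carrier (sec F a)\<rbrakk> \<Longrightarrow> trans F (ident C a) x = x"
    and trans_comp: "\<lbrakk>f \<in> arr C; g \<in> arr C; src C f = tgt C g; x \<in> carrier (sec F (tgt C f))\<rbrakk>
      \<Longrightarrow> trans F (f \<cdot> g) x = trans F g (trans F f x)"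

definition poset_nat_trans ::
  "('o, 'm) cat \<Rightarrow> ('o, 'm, 'l) presheaf \<Rightarrow> ('o, 'm, 'k) presheaf \<Rightarrow> ('o \<Rightarrow> 'l \<Rightarrow> 'k) \<Rightarrow> bool" where
  "poset_nat_trans C F G \<eta> \<longleftrightarrow>
     (\<forall>a\<in>obj C. \<eta> a \<in> carrier (sec F a) \<rightarrow> carrier (sec G a) \<and> isotone (sec F a) (sec G a) (\<eta> a)) \<and>
     (\<forall>r\<in>arr C. \<forall>x\<in>carrier (sec F (tgt C r)).
        trans G r (\<eta> (tgt C r) x) = \<eta> (src C r) (trans F r x))"

definition is_left_adjoint :: "'l gorder \<Rightarrow> 'k gorder \<Rightarrow> ('l \<Rightarrow> 'k) \<Rightarrow> ('k \<Rightarrow> 'l) \<Rightarrow> bool" where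
  "is_left_adjoint A B l u \<longleftrightarrow>
     galois_connection \<lparr>orderA = A, orderB = B, lower = l, upper = u\<rparr>"


section \<open>Internal frames\<close>

text \<open>For \<open>f : b \<rightarrow> a\<close>, the left adjoint \<open>\<Sigma>\<^sub>f : L b \<rightarrow> L a\<close> of \<open>L f\<close>. If one exists, the choice
  made here is immaterial, because adjoints are unique on the carrier.\<close>

definition Sigma_map :: "('o, 'm) cat \<Rightarrow> ('o, 'm, 'l) presheaf \<Rightarrow> 'm \<Rightarrow> 'l \<Rightarrow> 'l" where
  "Sigma_map C L f =
     (SOME s. is_left_adjoint (sec L (src C f)) (sec L (tgt C f)) s (trans L f))"

locale internal_frame = poset_presheaf C L
  for C :: "('o, 'm) cat" (structure) and L :: "('o, 'm, 'l) presheaf" +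
  assumes sec_frame: "a \<in> obj C \<Longrightarrow> frame (sec L a)"
    and trans_frame_hom: "f \<in> arr C \<Longrightarrow>
      frame_hom (sec L (tgt C f)) (sec L (src C f)) (trans L f)"
    and left_adjoint_exists: "f \<in> arr C \<Longrightarrow>
      \<exists>s. is_left_adjoint (sec L (src C f)) (sec L (tgt C f)) s (trans L f)"
    and beck_chevalley: "\<lbrakk>weak_pullback C r s p q; x \<in> carrier (sec L (src C r))\<rbrakk> \<Longrightarrow>
      trans L s (Sigma_map C L r x) = Sigma_map C L q (trans L p x)"
    and frobenius:
      "\<lbrakk>f \<in> arr C; u \<in> carrier (sec L (tgt C f)); v \<in> carrier (sec L (src C f))\<rbrakk> \<Longrightarrow>
        Sigma_map C L f (trans L f u \<sqinter>\<^bsub>sec L (src C f)\<^esub> v) =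
        u \<sqinter>\<^bsub>sec L (tgt C f)\<^esub> Sigma_map C L f v"

text \<open>A family \<open>(I\<^sub>f)\<close> indexed by the arrows into \<open>a\<close> is a function that is \<open>undefined\<close> off these
  arrows, so that equality of families is equality of functions.\<close>

definition ideal_families :: "('o, 'm) cat \<Rightarrow> ('o, 'm, 'l) presheaf \<Rightarrow> 'o \<Rightarrow> ('m \<Rightarrow> 'l set) set" where
  "ideal_families C L a =
     {I \<in> (\<Pi>\<^sub>E f\<in>arrows_into C a. carrier (idl (sec L (src C f)))).
        \<forall>f\<in>arrows_into C a. \<forall>g\<in>arrows_into C (src C f).
          ideal_image (sec L (src C g)) (trans L g) (I f) \<subseteq> I (f \<cdot>\<^bsub>C\<^esub> g)}"

definition internal_idl :: "('o, 'm) cat \<Rightarrow> ('o, 'm, 'l) presheaf \<Rightarrow> ('o, 'm, 'm \<Rightarrow> 'l set) presheaf"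
  where
  "internal_idl C L =
     \<lparr>sec = (\<lambda>a. \<lparr>carrier = ideal_families C L a, eq = (=),
                   le = (\<lambda>I J. \<forall>f\<in>arrows_into C a. I f \<subseteq> J f)\<rparr>),
      trans = (\<lambda>r I. \<lambda>h\<in>arrows_into C (src C r). I (r \<cdot>\<^bsub>C\<^esub> h))\<rparr>"

definition internal_Sup :: "('o, 'm) cat \<Rightarrow> ('o, 'm, 'l) presheaf \<Rightarrow> 'o \<Rightarrow> ('m \<Rightarrow> 'l set) \<Rightarrow> 'l" where
  "internal_Sup C L a I =
     \<Squnion>\<^bsub>sec L a\<^esub>(\<Union>f\<in>arrows_into C a. ideal_image (sec L a) (Sigma_map C L f) (I f))"

definition internally_locally_compact :: "('o, 'm) cat \<Rightarrow> ('o, 'm, 'l) presheaf \<Rightarrow> bool" where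
  "internally_locally_compact C L \<longleftrightarrow>
     (\<exists>\<Lambda>. poset_nat_trans C L (internal_idl C L) \<Lambda> \<and>
          (\<forall>a\<in>obj C. is_left_adjoint (sec L a) (sec (internal_idl C L) a)
                       (\<Lambda> a) (internal_Sup C L a)))"

end

theory Submission
  imports Defs
begin

text \<open>
  Let \<open>\<Lambda>\<close> be left adjoint to the internal supremum \<open>S\<close> and let \<open>x\<close> be an element of a section
  \<open>L a\<close>. The unit of the adjunction gives \<open>x \<sqsubseteq> S\<^sub>a (\<Lambda>\<^sub>a x)\<close>, so \<open>x\<close> is below the supremum
  of the elements of the ideals \<open>\<Sigma>\<^sub>f[\<Lambda>\<^sub>a x f]\<close>. The point is that all these elements are way below \<open>x\<close>
  in the ordinary frame \<open>L a\<close>.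

  To see this, let \<open>D\<close> be directed with \<open>x \<sqsubseteq> \<Squnion>D\<close>. Restricting \<open>D\<close> along every arrow \<open>f\<close> into
  \<open>a\<close> and closing downwards gives an ideal family \<open>J\<close> (\<open>restricted_ideals\<close>), whose internal
  supremum is above every \<open>d \<in> D\<close>, as its component at the identity contains \<open>d\<close>. Hence
  \<open>x \<sqsubseteq> S\<^sub>a J\<close>, and by adjointness \<open>\<Lambda>\<^sub>a x\<close> is contained in \<open>J\<close>: every \<open>u \<in> \<Lambda>\<^sub>a x f\<close> satisfies
  \<open>u \<sqsubseteq> L f d\<close> for some \<open>d \<in> D\<close>. Transposing this inequality gives \<open>\<Sigma>\<^sub>f u \<sqsubseteq> d\<close>, so
  \<open>\<Sigma>\<^sub>f u\<close> is way below \<open>x\<close> (\<open>Sigma_left_adjoint_way_below\<close>).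

  The elements way below \<open>x\<close> form an ideal in any complete lattice, so they are directed and
  contain the generated ideals \<open>\<Sigma>\<^sub>f[\<Lambda>\<^sub>a x f]\<close>; their supremum is therefore \<open>x\<close>.
\<close>

section \<open>Ideals and the way-below relation\<close>

lemma carrier_idl: "carrier (idl K) = {I. lattice_ideal K I}"
  by (simp add: idl_def)

lemma ideal_image_subset:
  assumes "lattice_ideal K' I" and "h ` X \<subseteq> I"
  shows "ideal_image K' h X \<subseteq> I"
  using assms by (auto simp: ideal_image_def ideal_generated_def carrier_idl)

lemma image_subset_ideal_image: "h ` X \<subseteq> ideal_image K' h X"
  by (auto simp: ideal_image_def ideal_generated_def)

context
  fixes K :: "'l gorder" (structure)
  assumes complete: "complete_lattice K"
begin

interpretation complete_lattice K
  by (rule complete)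

lemma lattice_ideal_directed:
  assumes I: "lattice_ideal K I"
  shows "directed K I"
proof -
  have sub: "I \<subseteq> carrier K" and "I \<noteq> {}"
    using I by (auto simp: lattice_ideal_def)
  moreover have "\<exists>z\<in>I. x \<sqsubseteq> z \<and> y \<sqsubseteq> z" if "x \<in> I" "y \<in> I" for x y
    using I that sub
    by (intro bexI[of _ "x \<squnion> y"]) (auto simp: lattice_ideal_def intro: join_left join_right)
  ultimately show ?thesis
    by (simp add: directed_def)
qed

lemma lattice_ideal_carrier: "lattice_ideal K (carrier K)"
  by (auto simp: lattice_ideal_def)

lemma way_below_imp_le:
  assumes "x \<in> carrier K" and "way_below K y x"
  shows "y \<sqsubseteq> x"
proof -
  have "directed K {x}" and "x \<sqsubseteq> \<Squnion>{x}"
    using assms(1) by (auto simp: directed_def)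
  then show ?thesis
    using assms(2) unfolding way_below_def by blast
qed

text \<open>A directed set is nonempty, so some member is above \<open>\<bottom>\<close>; members above \<open>y\<close> and above \<open>z\<close>
  have a common upper bound in the set, which is then above \<open>y \<squnion> z\<close>.\<close>

lemma way_below_lattice_ideal:
  "lattice_ideal K {y \<in> carrier K. way_below K y x}"
proof -
  have "way_below K \<bottom> x"
    unfolding way_below_def directed_def by (metis bottom_lower ex_in_conv subsetD)
  moreover have "way_below K z x"
    if y: "y \<in> carrier K" "way_below K y x" and z: "z \<in> carrier K" "z \<sqsubseteq> y" for y z
    unfolding way_below_def
  proof (intro allI impI)
    fix D assume D: "directed K D \<and> x \<sqsubseteq> \<Squnion>D"
    then obtain d where "d \<in> D" "y \<sqsubseteq> d"
      using y(2) unfolding way_below_def by blast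
    moreover have "d \<in> carrier K"
      using D \<open>d \<in> D\<close> by (auto simp: directed_def)
    ultimately show "\<exists>d\<in>D. z \<sqsubseteq> d"
      using le_trans[OF z(2)] y(1) z(1) by blast
  qed
  moreover have "way_below K (y \<squnion> z) x"
    if y: "y \<in> carrier K" "way_below K y x" and z: "z \<in> carrier K" "way_below K z x" for y z
    unfolding way_below_def
  proof (intro allI impI)
    fix D assume D: "directed K D \<and> x \<sqsubseteq> \<Squnion>D"
    then have DL: "D \<subseteq> carrier K"
      by (simp add: directed_def)
    obtain d where d: "d \<in> D" "y \<sqsubseteq> d"
      using D y(2) unfolding way_below_def by blast
    obtain e where e: "e \<in> D" "z \<sqsubseteq> e"
      using D z(2) unfolding way_below_def by blast
    obtain c where c: "c \<in> D" "d \<sqsubseteq> c" "e \<sqsubseteq> c"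
      using D d(1) e(1) unfolding directed_def by blast
    have dec: "d \<in> carrier K" "e \<in> carrier K" "c \<in> carrier K"
      using d(1) e(1) c(1) DL by auto
    have "y \<squnion> z \<sqsubseteq> c"
      using le_trans[OF d(2) c(2) y(1) dec(1,3)] le_trans[OF e(2) c(3) z(1) dec(2,3)] y(1) z(1) dec(3)
      by (rule join_le)
    then show "\<exists>d\<in>D. y \<squnion> z \<sqsubseteq> d"
      using c(1) by blast
  qed
  ultimately show ?thesis
    by (auto simp: lattice_ideal_def)
qed

end

text \<open>Local compactness reduces to one inequality: elements way below \<open>x\<close> are below \<open>x\<close>, which
  gives the other half of the supremum, and they are directed because binary joins exist.\<close>

lemma (in frame) locally_compact_frameI:
  assumes "\<And>x. x \<in> carrier K \<Longrightarrow> x \<sqsubseteq> \<Squnion>{y \<in> carrier K. way_below K y x}"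
  shows "locally_compact_frame K"
  unfolding locally_compact_frame_def
proof (intro conjI ballI)
  show "frame K"
    by (rule frame_axioms)
next
  fix x assume x: "x \<in> carrier K"
  let ?W = "{y \<in> carrier K. way_below K y x}"
  show "directed K ?W"
    by (rule lattice_ideal_directed[OF complete_lattice_axioms way_below_lattice_ideal[OF complete_lattice_axioms]])
  have "\<Squnion>?W \<sqsubseteq> x"
    using x by (intro sup_least) (auto simp: Upper_def intro: way_below_imp_le[OF complete_lattice_axioms])
  then have "\<Squnion>?W = x"
    using assms[OF x] x by (intro le_antisym) auto
  moreover have "is_lub K (\<Squnion>?W) ?W"
    by (rule sup_lub) auto
  ultimately show "is_lub K x ?W"
    by simp
qed

section \<open>Restricting a directed set to an ideal family\<close>

text \<open>For directed \<open>D\<close>, the ideal family obtained by restricting \<open>D \<subseteq> L a\<close> along all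
  arrows into \<open>a\<close>: it is the family \<open>(L f[I])\<^sub>f\<close> for the ideal \<open>I\<close> of elements below some member of \<open>D\<close>,
  described without generating ideals.\<close>

definition restricted_ideals ::
  "('o, 'm) cat \<Rightarrow> ('o, 'm, 'l) presheaf \<Rightarrow> 'o \<Rightarrow> 'l set \<Rightarrow> 'm \<Rightarrow> 'l set" where
  "restricted_ideals C L a D =
     (\<lambda>f\<in>arrows_into C a.
        {u \<in> carrier (sec L (src C f)). \<exists>d\<in>D. u \<sqsubseteq>\<^bsub>sec L (src C f)\<^esub> trans L f d})"

context internal_frame
begin

lemma sec_complete_lattice: "a \<in> obj C \<Longrightarrow> complete_lattice (sec L a)"
  using sec_frame by (auto simp: frame_def)

lemma trans_in_carrier:
  "\<lbrakk>f \<in> arr C; x \<in> carrier (sec L (tgt C f))\<rbrakk> \<Longrightarrow> trans L f x \<in> carrier (sec L (src C f))"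
  using trans_closed by blast

lemma trans_le:
  "\<lbrakk>f \<in> arr C; x \<in> carrier (sec L (tgt C f)); y \<in> carrier (sec L (tgt C f));
    x \<sqsubseteq>\<^bsub>sec L (tgt C f)\<^esub> y\<rbrakk> \<Longrightarrow> trans L f x \<sqsubseteq>\<^bsub>sec L (src C f)\<^esub> trans L f y"
  using trans_mono by (auto simp: isotone_def)

lemma Sigma_left_adjoint:
  assumes "f \<in> arr C"
  shows "is_left_adjoint (sec L (src C f)) (sec L (tgt C f)) (Sigma_map C L f) (trans L f)"
  unfolding Sigma_map_def by (rule someI_ex[OF left_adjoint_exists[OF assms]])

lemma Sigma_in_carrier:
  assumes "f \<in> arr C" and "u \<in> carrier (sec L (src C f))"
  shows "Sigma_map C L f u \<in> carrier (sec L (tgt C f))"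
  using connection.lower_closed[OF galois_connection.axioms(1)
      [OF Sigma_left_adjoint[OF assms(1), unfolded is_left_adjoint_def]]] assms(2)
  by simp

lemma Sigma_le_iff:
  assumes "f \<in> arr C" and "u \<in> carrier (sec L (src C f))" and "v \<in> carrier (sec L (tgt C f))"
  shows "Sigma_map C L f u \<sqsubseteq>\<^bsub>sec L (tgt C f)\<^esub> v \<longleftrightarrow> u \<sqsubseteq>\<^bsub>sec L (src C f)\<^esub> trans L f v"
  using galois_connection.galois_property
      [OF Sigma_left_adjoint[OF assms(1), unfolded is_left_adjoint_def]] assms(2,3)
  by simp

lemma restricted_lattice_ideal:
  assumes f: "f \<in> arr C" and D: "directed (sec L (tgt C f)) D"
  shows "lattice_ideal (sec L (src C f))
    {u \<in> carrier (sec L (src C f)). \<exists>d\<in>D. u \<sqsubseteq>\<^bsub>sec L (src C f)\<^esub> trans L f d}"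
proof -
  interpret K: complete_lattice "sec L (src C f)"
    by (rule sec_complete_lattice[OF src_obj[OF f]])
  have DL: "D \<subseteq> carrier (sec L (tgt C f))" and "D \<noteq> {}"
    using D by (auto simp: directed_def)
  have closed: "trans L f d \<in> carrier (sec L (src C f))" if "d \<in> D" for d
    using f that DL by (blast intro: trans_in_carrier)
  have "\<exists>d\<in>D. \<bottom>\<^bsub>sec L (src C f)\<^esub> \<sqsubseteq>\<^bsub>sec L (src C f)\<^esub> trans L f d"
    using \<open>D \<noteq> {}\<close> closed by blast
  moreover have "\<exists>c\<in>D. u \<squnion>\<^bsub>sec L (src C f)\<^esub> v \<sqsubseteq>\<^bsub>sec L (src C f)\<^esub> trans L f c"
    if u: "u \<in> carrier (sec L (src C f))" "d \<in> D" "u \<sqsubseteq>\<^bsub>sec L (src C f)\<^esub> trans L f d"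
      and v: "v \<in> carrier (sec L (src C f))" "e \<in> D" "v \<sqsubseteq>\<^bsub>sec L (src C f)\<^esub> trans L f e"
    for u v d e
  proof -
    obtain c where c: "c \<in> D" "d \<sqsubseteq>\<^bsub>sec L (tgt C f)\<^esub> c" "e \<sqsubseteq>\<^bsub>sec L (tgt C f)\<^esub> c"
      using D u(2) v(2) unfolding directed_def by blast
    have "trans L f d \<sqsubseteq>\<^bsub>sec L (src C f)\<^esub> trans L f c"
      and "trans L f e \<sqsubseteq>\<^bsub>sec L (src C f)\<^esub> trans L f c"
      using f c u(2) v(2) DL by (blast intro: trans_le)+
    then have "u \<sqsubseteq>\<^bsub>sec L (src C f)\<^esub> trans L f c" "v \<sqsubseteq>\<^bsub>sec L (src C f)\<^esub> trans L f c"
      using K.le_trans[OF u(3) _ u(1)] K.le_trans[OF v(3) _ v(1)] u(2) v(2) c(1) closed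
      by simp_all
    then have "u \<squnion>\<^bsub>sec L (src C f)\<^esub> v \<sqsubseteq>\<^bsub>sec L (src C f)\<^esub> trans L f c"
      using u(1) v(1) closed[OF c(1)] by (rule K.join_le)
    then show ?thesis
      using c(1) by blast
  qed
  moreover have "\<exists>d\<in>D. v \<sqsubseteq>\<^bsub>sec L (src C f)\<^esub> trans L f d"
    if "u \<in> carrier (sec L (src C f))" "d \<in> D" "u \<sqsubseteq>\<^bsub>sec L (src C f)\<^esub> trans L f d"
      "v \<in> carrier (sec L (src C f))" "v \<sqsubseteq>\<^bsub>sec L (src C f)\<^esub> u" for u v d
    using K.le_trans[OF that(5) that(3) that(4) that(1) closed[OF that(2)]] that(2) by blast
  ultimately show ?thesis
    by (auto simp: lattice_ideal_def)
qed

text \<open>Compatibility with transition maps is functoriality of \<open>L\<close>: from \<open>u \<sqsubseteq> L f d\<close> follows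
  \<open>L g u \<sqsubseteq> L g (L f d) = L (f \<cdot> g) d\<close>.\<close>

lemma restricted_ideals_family:
  assumes D: "directed (sec L a) D"
  shows "restricted_ideals C L a D \<in> ideal_families C L a"
proof -
  have ideal: "lattice_ideal (sec L (src C f)) (restricted_ideals C L a D f)"
    if "f \<in> arrows_into C a" for f
    using restricted_lattice_ideal[of f D] D that
    by (auto simp: restricted_ideals_def arrows_into_def)
  have "ideal_image (sec L (src C g)) (trans L g) (restricted_ideals C L a D f)
      \<subseteq> restricted_ideals C L a D (f \<cdot> g)"
    if f: "f \<in> arrows_into C a" and g: "g \<in> arrows_into C (src C f)" for f g
  proof (rule ideal_image_subset)
    have fa: "f \<in> arr C" "tgt C f = a" and ga: "g \<in> arr C" "tgt C g = src C f"
      using f g by (auto simp: arrows_into_def)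
    have fg: "f \<cdot> g \<in> arrows_into C a" and src: "src C (f \<cdot> g) = src C g"
      using fa ga by (auto simp: arrows_into_def comp_arr tgt_comp src_comp)
    show "lattice_ideal (sec L (src C g)) (restricted_ideals C L a D (f \<cdot> g))"
      using ideal[OF fg] src by simp
    show "trans L g ` restricted_ideals C L a D f \<subseteq> restricted_ideals C L a D (f \<cdot> g)"
    proof
      fix w assume "w \<in> trans L g ` restricted_ideals C L a D f"
      then obtain u d where w: "w = trans L g u" and u: "u \<in> carrier (sec L (src C f))"
        and d: "d \<in> D" and le: "u \<sqsubseteq>\<^bsub>sec L (src C f)\<^esub> trans L f d"
        using f by (auto simp: restricted_ideals_def)
      have dL: "d \<in> carrier (sec L (tgt C f))"
        using D d fa by (auto simp: directed_def)
      have "w \<in> carrier (sec L (src C g))"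
        using w u ga trans_in_carrier by simp
      moreover have "w \<sqsubseteq>\<^bsub>sec L (src C g)\<^esub> trans L g (trans L f d)"
        using w u le ga fa dL trans_in_carrier trans_le by simp
      then have "w \<sqsubseteq>\<^bsub>sec L (src C g)\<^esub> trans L (f \<cdot> g) d"
        using trans_comp[OF fa(1) ga(1) _ dL] ga(2) by simp
      ultimately show "w \<in> restricted_ideals C L a D (f \<cdot> g)"
        using fg d src by (auto simp: restricted_ideals_def)
    qed
  qed
  moreover have "restricted_ideals C L a D \<in>
      (\<Pi>\<^sub>E f\<in>arrows_into C a. carrier (idl (sec L (src C f))))"
    using ideal by (simp add: PiE_iff carrier_idl) (simp add: restricted_ideals_def)
  ultimately show ?thesis
    by (simp add: ideal_families_def)
qed

lemma Sigma_ideal_images_subset_carrier: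
  assumes a: "a \<in> obj C" and I: "I \<in> ideal_families C L a"
  shows "(\<Union>f\<in>arrows_into C a. ideal_image (sec L a) (Sigma_map C L f) (I f))
    \<subseteq> carrier (sec L a)"
proof (rule UN_least)
  fix f assume f: "f \<in> arrows_into C a"
  then have fa: "f \<in> arr C" "tgt C f = a"
    by (auto simp: arrows_into_def)
  have "lattice_ideal (sec L (src C f)) (I f)"
    using I f by (auto simp: ideal_families_def carrier_idl)
  then have "Sigma_map C L f ` I f \<subseteq> carrier (sec L a)"
    using Sigma_in_carrier[OF fa(1)] fa(2) by (auto simp: lattice_ideal_def)
  then show "ideal_image (sec L a) (Sigma_map C L f) (I f) \<subseteq> carrier (sec L a)"
    by (rule ideal_image_subset
        [OF lattice_ideal_carrier[OF sec_complete_lattice[OF a]]])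
qed

text \<open>The component at the identity suffices: it contains \<open>D\<close>, and \<open>\<Sigma>\<close> along the identity is
  inflationary, being left adjoint to an identity map.\<close>

lemma Sup_le_internal_Sup_restricted_ideals:
  assumes a: "a \<in> obj C" and D: "directed (sec L a) D"
  shows "\<Squnion>\<^bsub>sec L a\<^esub>D \<sqsubseteq>\<^bsub>sec L a\<^esub> internal_Sup C L a (restricted_ideals C L a D)"
proof -
  interpret K: complete_lattice "sec L a"
    by (rule sec_complete_lattice[OF a])
  let ?J = "restricted_ideals C L a D"
  let ?U = "\<Union>f\<in>arrows_into C a. ideal_image (sec L a) (Sigma_map C L f) (?J f)"
  have i: "ident C a \<in> arr C" "src C (ident C a) = a" "tgt C (ident C a) = a"
    using a by (simp_all add: ident_arr src_ident tgt_ident)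
  have U: "?U \<subseteq> carrier (sec L a)"
    by (rule Sigma_ideal_images_subset_carrier[OF a restricted_ideals_family[OF D]])
  have DL: "D \<subseteq> carrier (sec L a)"
    using D by (simp add: directed_def)
  have "d \<sqsubseteq>\<^bsub>sec L a\<^esub> \<Squnion>\<^bsub>sec L a\<^esub>?U" if d: "d \<in> D" for d
  proof -
    let ?s = "Sigma_map C L (ident C a) d"
    have dL: "d \<in> carrier (sec L a)"
      using d DL by blast
    have s: "?s \<in> carrier (sec L a)"
      using Sigma_in_carrier[OF i(1)] i dL by simp
    have "d \<sqsubseteq>\<^bsub>sec L a\<^esub> trans L (ident C a) ?s"
      using Sigma_le_iff[OF i(1), of d ?s] i s dL by simp
    then have "d \<sqsubseteq>\<^bsub>sec L a\<^esub> ?s"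
      using trans_ident[OF a s] by simp
    moreover have "d \<in> ?J (ident C a)"
      using i d dL trans_ident[OF a dL]
      by (auto simp: restricted_ideals_def arrows_into_def intro!: bexI[of _ d])
    then have "?s \<in> ?U"
      using image_subset_ideal_image[of "Sigma_map C L (ident C a)" "?J (ident C a)" "sec L a"] i
      by (fastforce simp: arrows_into_def)
    then have "?s \<sqsubseteq>\<^bsub>sec L a\<^esub> \<Squnion>\<^bsub>sec L a\<^esub>?U"
      using U by (blast intro: K.sup_upper)
    ultimately show ?thesis
      using K.le_trans dL s K.sup_closed[OF U] by blast
  qed
  then have "\<Squnion>\<^bsub>sec L a\<^esub>D \<sqsubseteq>\<^bsub>sec L a\<^esub> \<Squnion>\<^bsub>sec L a\<^esub>?U"
    using DL K.sup_closed[OF U] by (intro K.sup_least) (auto simp: Upper_def)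
  then show ?thesis
    by (simp add: internal_Sup_def)
qed

section \<open>The left adjoint of the internal supremum\<close>

text \<open>A directed set covering \<open>x\<close> yields, by \<open>restricted_ideals\<close>, a family \<open>J\<close> with
  \<open>x \<sqsubseteq> S\<^sub>a J\<close>; this bounds \<open>\<Lambda> x\<close> by \<open>J\<close>. The adjunction \<open>\<Sigma>\<^sub>f \<stileturn> L f\<close> then carries the bound
  from the section over the source of \<open>f\<close> back to \<open>L a\<close>.\<close>

lemma Sigma_left_adjoint_way_below:
  assumes a: "a \<in> obj C"
    and adj: "is_left_adjoint (sec L a) (sec (internal_idl C L) a) \<Lambda> (internal_Sup C L a)"
    and x: "x \<in> carrier (sec L a)"
    and f: "f \<in> arrows_into C a"
    and u: "u \<in> carrier (sec L (src C f))" "u \<in> \<Lambda> x f"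
  shows "way_below (sec L a) (Sigma_map C L f u) x"
  unfolding way_below_def
proof (intro allI impI, elim conjE)
  fix D assume D: "directed (sec L a) D" and xD: "x \<sqsubseteq>\<^bsub>sec L a\<^esub> \<Squnion>\<^bsub>sec L a\<^esub>D"
  interpret K: complete_lattice "sec L a"
    by (rule sec_complete_lattice[OF a])
  interpret adj: galois_connection "\<lparr>orderA = sec L a, orderB = sec (internal_idl C L) a,
      lower = \<Lambda>, upper = internal_Sup C L a\<rparr>"
    using adj by (simp add: is_left_adjoint_def)
  let ?J = "restricted_ideals C L a D"
  have DL: "D \<subseteq> carrier (sec L a)"
    using D by (simp add: directed_def)
  have J: "?J \<in> carrier (sec (internal_idl C L) a)"
    using restricted_ideals_family[OF D] by (simp add: internal_idl_def)
  have SJ: "internal_Sup C L a ?J \<in> carrier (sec L a)"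
    using adj.upper_closed J by simp
  have "x \<sqsubseteq>\<^bsub>sec L a\<^esub> internal_Sup C L a ?J"
    using K.le_trans[OF xD Sup_le_internal_Sup_restricted_ideals[OF a D]] x SJ
      K.sup_closed[OF DL] by blast
  then have "\<Lambda> x \<sqsubseteq>\<^bsub>sec (internal_idl C L) a\<^esub> ?J"
    using adj.left x J by simp
  then have "\<Lambda> x f \<subseteq> ?J f"
    using f by (simp add: internal_idl_def)
  then obtain d where d: "d \<in> D" "u \<sqsubseteq>\<^bsub>sec L (src C f)\<^esub> trans L f d"
    using u(2) f by (auto simp: restricted_ideals_def)
  moreover have "f \<in> arr C" "tgt C f = a"
    using f by (auto simp: arrows_into_def)
  ultimately show "\<exists>d\<in>D. Sigma_map C L f u \<sqsubseteq>\<^bsub>sec L a\<^esub> d"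
    using Sigma_le_iff[of f u d] u(1) DL by auto
qed

lemma section_locally_compact:
  assumes a: "a \<in> obj C"
    and adj: "is_left_adjoint (sec L a) (sec (internal_idl C L) a) \<Lambda> (internal_Sup C L a)"
  shows "locally_compact_frame (sec L a)"
proof (rule frame.locally_compact_frameI[OF sec_frame[OF a]])
  fix x assume x: "x \<in> carrier (sec L a)"
  interpret K: complete_lattice "sec L a"
    by (rule sec_complete_lattice[OF a])
  interpret adj: galois_connection "\<lparr>orderA = sec L a, orderB = sec (internal_idl C L) a,
      lower = \<Lambda>, upper = internal_Sup C L a\<rparr>"
    using adj by (simp add: is_left_adjoint_def)
  let ?W = "{y \<in> carrier (sec L a). way_below (sec L a) y x}"
  let ?U = "\<Union>f\<in>arrows_into C a. ideal_image (sec L a) (Sigma_map C L f) (\<Lambda> x f)"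
  have I: "\<Lambda> x \<in> ideal_families C L a"
    using adj.lower_closed x by (simp add: internal_idl_def)
  have U: "?U \<subseteq> ?W"
  proof (intro UN_least ideal_image_subset way_below_lattice_ideal K.complete_lattice_axioms)
    fix f assume f: "f \<in> arrows_into C a"
    then have "\<Lambda> x f \<subseteq> carrier (sec L (src C f))"
      using I by (auto simp: ideal_families_def carrier_idl lattice_ideal_def)
    then show "Sigma_map C L f ` \<Lambda> x f \<subseteq> ?W"
      using Sigma_left_adjoint_way_below[OF a adj x f] Sigma_in_carrier[of f] f
      by (auto simp: arrows_into_def)
  qed
  have "x \<sqsubseteq>\<^bsub>sec L a\<^esub> \<Squnion>\<^bsub>sec L a\<^esub>?U"
    using adj.inflation x by (simp add: internal_Sup_def)
  moreover have "\<Squnion>\<^bsub>sec L a\<^esub>?U \<sqsubseteq>\<^bsub>sec L a\<^esub> \<Squnion>\<^bsub>sec L a\<^esub>?W"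
  proof (rule K.sup_least)
    show "?U \<subseteq> carrier (sec L a)"
      using U by blast
    show "\<And>y. y \<in> ?U \<Longrightarrow> y \<sqsubseteq>\<^bsub>sec L a\<^esub> \<Squnion>\<^bsub>sec L a\<^esub>?W"
      by (rule K.sup_upper) (use U in blast)+
  qed auto
  moreover have "?U \<subseteq> carrier (sec L a)" "?W \<subseteq> carrier (sec L a)"
    using U by blast+
  ultimately show "x \<sqsubseteq>\<^bsub>sec L a\<^esub> \<Squnion>\<^bsub>sec L a\<^esub>?W"
    using K.le_trans x K.sup_closed by presburger
qed

end

theorem proposition3p1:
  fixes C :: "('o, 'm) cat" and L :: "('o, 'm, 'l) presheaf"
  assumes "category C"
    and "has_weak_pullbacks C"
    and "internal_frame C L"
    and "internally_locally_compact C L"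
  shows "\<forall>a\<in>obj C. locally_compact_frame (sec L a)"
  using internal_frame.section_locally_compact[OF assms(3)] assms(4)
  unfolding internally_locally_compact_def by blast

end
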